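(* Let $n\in\mathbb N$ and let $m,M$ be positive real numbers satisfying \[ \frac{n}{M-n+1}\le m\le n-1+\frac{n}{M} \qquad\text{and}\qquad 0<m\le n\le M . \] Then there exists a finite Blaschke product $B$ of degree $n$ with $M(B)=M$ and $m(B)=m$.
   Context: A finite Blaschke product of degree $n$ is a function $B(z)=\alpha\prod_{k=1}^n \frac{z-a_k}{1-\overline{a_k}z}$ with $a_1,\dots,a_n\in\mathbb D=\{|z|<1\}$ and $\alpha\in\mathbb T=\{|z|=1\}$. For such $B$, $M(B)=\sup_{|z|=1}|B'(z)|$ and $m(B)=\inf_{|z|=1}|B'(z)|$. *)

theory Defs
  imports "HOL-Analysis.Analysis"
begin

definition blaschke :: "complex \<Rightarrow> (nat \<Rightarrow> complex) \<Rightarrow> nat \<Rightarrow> complex \<Rightarrow> complex" where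
  "blaschke alpha a n z = alpha * (\<Prod>k<n. (z - a k) / (1 - cnj (a k) * z))"

definition is_blaschke :: "nat \<Rightarrow> (complex \<Rightarrow> complex) \<Rightarrow> bool" where
  "is_blaschke n B \<longleftrightarrow> (\<exists>alpha a. norm alpha = 1 \<and> (\<forall>k<n. norm (a k) < 1) \<and>
      B = blaschke alpha a n)"

definition maxderiv :: "(complex \<Rightarrow> complex) \<Rightarrow> real" where
  "maxderiv B = (SUP z\<in>sphere 0 1. norm (deriv B z))"

definition minderiv :: "(complex \<Rightarrow> complex) \<Rightarrow> real" where
  "minderiv B = (INF z\<in>sphere 0 1. norm (deriv B z))"

end

theory Submission
  imports Defs "HOL-Complex_Analysis.Complex_Analysis"
    "HOL-Computational_Algebra.Fundamental_Theorem_Algebra"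
begin

text \<open>
  On the unit circle \<open>|B'|\<close> is the sum \<open>F\<close> of the Poisson kernels of the zeros of \<open>B\<close>.
  Multiplying all zeros by \<open>t\<close> replaces \<open>F\<close> by a dilation of its harmonic extension, so by the
  maximum principle \<open>max F\<close> is strictly increasing and \<open>min F\<close> is decreasing in \<open>t\<close>. Hence for
  \<open>M > n\<close> each direction in the space of nonzero zero tuples contains exactly one tuple with
  \<open>max F = M\<close>; this tuple depends continuously on the direction, and \<open>min F\<close> takes all values
  between any two of its values on this connected level set.

  It remains to reach the two extreme values. For every zero tuple and every fibre
  \<open>z\<^sub>0, ..., z\<^sub>n\<close> of \<open>z B(z)\<close> one has \<open>\<Sum> 1 / (1 + F(z\<^sub>k)) = 1\<close>, so in an extreme case \<open>F\<close> is
  extremal at \<open>z\<^sub>0 = 1\<close> and has the same critical value at all other \<open>z\<^sub>k\<close>. These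
  \<open>z\<^sub>k\<close> are then in logarithmic equilibrium with a charge \<open>p\<close> at \<open>1\<close>, i.e. they are the
  zeros of the polynomial \<open>q\<close> that corresponds to the Gegenbauer polynomial with parameter \<open>p\<close>, and
  \<open>B\<close> has numerator \<open>N = p q - (1 - z) q'\<close>. One finds
  \<open>F - (n - 1 + p) = (1 - p) p (p + n) |q|\<^sup>2 / |N|\<^sup>2\<close> and \<open>F(1) = n / p\<close>; the choices \<open>p = n / M\<close>
  and \<open>p = M - n + 1\<close> give the two extreme cases.
\<close>

section \<open>The derivative on the unit circle\<close>

text \<open>On the circle each summand is the Poisson kernel of \<open>a k\<close>
  (\<open>poisson_kernel_eq\<close>); the form as a real part suits both logarithmic derivatives and
  harmonic extension.\<close>

definition poisson_sum :: "nat \<Rightarrow> (nat \<Rightarrow> complex) \<Rightarrow> complex \<Rightarrow> real" where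
  "poisson_sum n a z = (\<Sum>k<n. Re ((z + a k) / (z - a k)))"

lemma poisson_kernel_eq:
  fixes a z :: complex
  assumes "norm z = 1"
  shows "Re ((z + a) / (z - a)) = (1 - (norm a)\<^sup>2) / (norm (z - a))\<^sup>2"
proof -
  have "Re ((z + a) * cnj (z - a)) = 1 - (norm a)\<^sup>2"
    using assms by (simp add: cmod_def power2_eq_square algebra_simps)
  then show ?thesis
    by (simp add: complex_div_cnj[of "z + a"] Re_divide_of_real flip: of_real_power)
qed

lemma blaschke_factor_eq:
  fixes a z :: complex
  assumes "norm z = 1"
  shows "1 - cnj a * z = z * cnj (z - a)"
proof -
  have "z * cnj z = 1"
    using assms by (simp add: complex_norm_square[symmetric])
  then show ?thesis
    by (simp add: algebra_simps)
qed

text \<open>On the circle \<open>1 - cnj a * z = z * cnj (z - a)\<close>, so the logarithmic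
  derivative of each factor is its Poisson kernel divided by \<open>z\<close>; the product rule adds
  the kernels.\<close>

lemma blaschke_has_derivative:
  assumes "\<forall>k<n. norm (a k) < 1" "norm z = 1"
  shows "(blaschke alpha a n has_field_derivative
           blaschke alpha a n z * poisson_sum n a z / z) (at z)"
  using assms(1)
proof (induction n)
  case 0
  then show ?case
    by (simp add: blaschke_def poisson_sum_def)
next
  case (Suc n)
  have a: "norm (a n) < 1" and z0: "z \<noteq> 0" and za: "z \<noteq> a n"
    using Suc.prems assms(2) by auto
  have d0: "1 - cnj (a n) * z \<noteq> 0"
    using blaschke_factor_eq[OF assms(2), of "a n"] z0 za by auto
  have split: "blaschke alpha a (Suc n) w =
      blaschke alpha a n w * ((w - a n) / (1 - cnj (a n) * w))" for w
    by (simp add: blaschke_def)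
  have "((\<lambda>w. (w - a n) / (1 - cnj (a n) * w)) has_field_derivative
          (1 - cnj (a n) * a n) / (1 - cnj (a n) * z)\<^sup>2) (at z)"
    using d0 by (auto intro!: derivative_eq_intros simp: power2_eq_square divide_simps)
       (simp add: algebra_simps)
  also have "(1 - cnj (a n) * a n) / (1 - cnj (a n) * z)\<^sup>2 =
      (z - a n) / (1 - cnj (a n) * z) * complex_of_real (Re ((z + a n) / (z - a n))) / z"
  proof -
    have "complex_of_real (Re ((z + a n) / (z - a n))) =
        (1 - cnj (a n) * a n) / ((z - a n) * cnj (z - a n))"
      unfolding poisson_kernel_eq[OF assms(2)]
      by (simp only: of_real_divide of_real_diff of_real_1 complex_norm_square)
         (simp add: mult.commute)
    moreover have "x / (z * e)\<^sup>2 = d / (z * e) * (x / (d * e)) / z" if "d \<noteq> 0" for x d e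
      using z0 that by (cases "e = 0") (simp_all add: field_simps power2_eq_square)
    ultimately show ?thesis
      unfolding blaschke_factor_eq[OF assms(2)] using za by (metis right_minus_eq)
  qed
  finally have f: "((\<lambda>w. (w - a n) / (1 - cnj (a n) * w)) has_field_derivative
      (z - a n) / (1 - cnj (a n) * z) * complex_of_real (Re ((z + a n) / (z - a n))) / z) (at z)" .
  have D: "((\<lambda>w. blaschke alpha a n w * ((w - a n) / (1 - cnj (a n) * w))) has_field_derivative
      blaschke alpha a n z * poisson_sum n a z / z * ((z - a n) / (1 - cnj (a n) * z)) +
      (z - a n) / (1 - cnj (a n) * z) * complex_of_real (Re ((z + a n) / (z - a n))) / z *
      blaschke alpha a n z) (at z)"
    using Suc by (intro DERIV_mult f) auto
  have collect: "b * x / z * c + c * y / z * b = b * c * (x + y) / z" for b x c y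
    by (simp add: ring_distribs add_divide_distrib mult_ac)
  have "complex_of_real (poisson_sum (Suc n) a z) =
      poisson_sum n a z + complex_of_real (Re ((z + a n) / (z - a n)))"
    by (simp add: poisson_sum_def)
  then show ?case
    unfolding split[abs_def] using D unfolding collect by (simp only:)
qed

lemma poisson_kernel_nonneg:
  fixes a z :: complex
  assumes "norm a < 1" "norm z = 1"
  shows "0 \<le> Re ((z + a) / (z - a))"
  unfolding poisson_kernel_eq[OF assms(2)] using assms(1) by (simp add: power_le_one)

lemma poisson_sum_nonneg:
  assumes "\<forall>k<n. norm (a k) < 1" "norm z = 1"
  shows "0 \<le> poisson_sum n a z"
  unfolding poisson_sum_def using assms by (intro sum_nonneg poisson_kernel_nonneg) auto

lemma norm_deriv_blaschke:
  assumes "norm alpha = 1" "\<forall>k<n. norm (a k) < 1" "norm z = 1"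
  shows "norm (deriv (blaschke alpha a n) z) = poisson_sum n a z"
proof -
  have "norm ((z - a k) / (1 - cnj (a k) * z)) = 1" if "k < n" for k
    unfolding blaschke_factor_eq[OF assms(3)] norm_divide norm_mult complex_mod_cnj
    using assms that by auto
  then have "norm (blaschke alpha a n z) = 1"
    using assms(1) by (simp add: blaschke_def norm_mult prod_norm[symmetric])
  moreover have "deriv (blaschke alpha a n) z = blaschke alpha a n z * poisson_sum n a z / z"
    using blaschke_has_derivative[OF assms(2,3)] by (rule DERIV_imp_deriv)
  ultimately show ?thesis
    using assms(3) poisson_sum_nonneg[OF assms(2,3)] by (simp add: norm_mult norm_divide)
qed

section \<open>Extremal zero tuples\<close>

text \<open>The recursion below is the Szego recursion for the polynomials orthogonal on the unit
  circle with respect to the weight \<open>|1 - z| ^ (2 p)\<close>; \<open>szego_rev p n\<close> is the reversal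
  of \<open>szego p n\<close>.\<close>

fun szego :: "real \<Rightarrow> nat \<Rightarrow> complex poly" and szego_rev :: "real \<Rightarrow> nat \<Rightarrow> complex poly" where
  "szego p 0 = 1"
| "szego_rev p 0 = 1"
| "szego p (Suc n) = smult (of_real (1 / real (Suc n)))
     (smult (of_real (real (Suc n) + p)) (pCons 0 (szego p n)) + smult (of_real p) (szego_rev p n))"
| "szego_rev p (Suc n) = smult (of_real (1 / real (Suc n)))
     (smult (of_real (real (Suc n) + p)) (szego_rev p n) + smult (of_real p) (pCons 0 (szego p n)))"

section \<open>First-order differential relations for the Szego polynomials\<close>

lemma poly_szego_Suc:
  "of_nat (Suc n) * poly (szego p (Suc n)) z =
     (of_nat (Suc n) + of_real p) * (z * poly (szego p n) z) + of_real p * poly (szego_rev p n) z"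
  "of_nat (Suc n) * poly (szego_rev p (Suc n)) z =
     (of_nat (Suc n) + of_real p) * poly (szego_rev p n) z + of_real p * (z * poly (szego p n) z)"
proof -
  have "(of_nat (Suc n) :: complex) \<noteq> 0" by (rule of_nat_neq_0)
  then show
    "of_nat (Suc n) * poly (szego p (Suc n)) z =
       (of_nat (Suc n) + of_real p) * (z * poly (szego p n) z) + of_real p * poly (szego_rev p n) z"
    "of_nat (Suc n) * poly (szego_rev p (Suc n)) z =
       (of_nat (Suc n) + of_real p) * poly (szego_rev p n) z + of_real p * (z * poly (szego p n) z)"
    by (simp_all del: of_nat_Suc)
qed

lemma poly_pderiv_szego_Suc:
  "of_nat (Suc n) * poly (pderiv (szego p (Suc n))) z =
     (of_nat (Suc n) + of_real p) * (poly (szego p n) z + z * poly (pderiv (szego p n)) z)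
       + of_real p * poly (pderiv (szego_rev p n)) z"
  "of_nat (Suc n) * poly (pderiv (szego_rev p (Suc n))) z =
     (of_nat (Suc n) + of_real p) * poly (pderiv (szego_rev p n)) z
       + of_real p * (poly (szego p n) z + z * poly (pderiv (szego p n)) z)"
proof -
  have "(of_nat (Suc n) :: complex) \<noteq> 0" by (rule of_nat_neq_0)
  then show
    "of_nat (Suc n) * poly (pderiv (szego p (Suc n))) z =
       (of_nat (Suc n) + of_real p) * (poly (szego p n) z + z * poly (pderiv (szego p n)) z)
         + of_real p * poly (pderiv (szego_rev p n)) z"
    "of_nat (Suc n) * poly (pderiv (szego_rev p (Suc n))) z =
       (of_nat (Suc n) + of_real p) * poly (pderiv (szego_rev p n)) z
         + of_real p * (poly (szego p n) z + z * poly (pderiv (szego p n)) z)"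
    by (simp_all add: pderiv_add pderiv_smult pderiv_pCons ring_distribs mult_ac del: of_nat_Suc)
qed

text \<open>Both relations need a joint induction, because each recursion step and its derivative
  mix the two polynomials. Multiplying by \<open>Suc n\<close> clears the denominators of the
  recursion.\<close>

lemma szego_derivative:
  "z * (1 - z) * poly (pderiv (szego p n)) z =
     (of_real p + of_nat n * (1 - z)) * poly (szego p n) z - of_real p * poly (szego_rev p n) z"
  "(1 - z) * poly (pderiv (szego_rev p n)) z =
     of_real p * (poly (szego_rev p n) z - poly (szego p n) z)"
proof (induction n)
  case 0
  { case 1 show ?case by simp }
  { case 2 show ?case by simp }
next
  case (Suc n)
  have N: "(of_nat (Suc n) :: complex) \<noteq> 0" by (rule of_nat_neq_0)
  have S: "(of_nat (Suc n) :: complex) = 1 + of_nat n" by simp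
  note rec = poly_szego_Suc[of n p z] poly_pderiv_szego_Suc[of n p z]
  {
    case 1
    have "of_nat (Suc n) * (z * (1 - z) * poly (pderiv (szego p (Suc n))) z) =
      of_nat (Suc n) * ((of_real p + of_nat (Suc n) * (1 - z)) * poly (szego p (Suc n)) z
        - of_real p * poly (szego_rev p (Suc n)) z)"
      using rec Suc.IH unfolding S by algebra
    then show ?case using N by simp
  next
    case 2
    have "of_nat (Suc n) * ((1 - z) * poly (pderiv (szego_rev p (Suc n))) z) =
      of_nat (Suc n) * (of_real p * (poly (szego_rev p (Suc n)) z - poly (szego p (Suc n)) z))"
      using rec Suc.IH unfolding S by algebra
    then show ?case using N by simp
  }
qed

section \<open>Moduli of the Szego polynomials on and outside the unit circle\<close>

lemma norm_reflected_combination: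
  fixes A B :: complex and s t :: real
  shows "(norm (of_real s * A + of_real t * B))\<^sup>2 - (norm (of_real s * B + of_real t * A))\<^sup>2 =
    (s\<^sup>2 - t\<^sup>2) * ((norm A)\<^sup>2 - (norm B)\<^sup>2)"
  unfolding cmod_power2 by (simp add: power2_eq_square algebra_simps)

text \<open>Induction: outside the disc the factor \<open>z\<close> can only enlarge
  \<open>A\<close>, the identity \<open>norm_reflected_combination\<close> passes
  \<open>norm B \<le> norm A\<close> on to the next pair, and \<open>p < s\<close> keeps the new
  value of \<open>szego\<close> from vanishing.\<close>

lemma szego_dominates_rev:
  assumes "p > 0" "norm z \<ge> 1"
  shows "poly (szego p n) z \<noteq> 0 \<and> norm (poly (szego_rev p n) z) \<le> norm (poly (szego p n) z)"
proof (induction n)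
  case 0
  show ?case by simp
next
  case (Suc n)
  define A where "A = z * poly (szego p n) z"
  define B where "B = poly (szego_rev p n) z"
  define s where "s = real (Suc n) + p"
  have "norm (poly (szego p n) z) \<le> norm A"
    using assms(2) by (simp add: A_def norm_mult mult_le_cancel_right1)
  then have BA: "norm B \<le> norm A" and A0: "norm A > 0"
    using Suc by (auto simp: B_def intro: less_le_trans)
  have rec: "of_nat (Suc n) * poly (szego p (Suc n)) z = of_real s * A + of_real p * B"
    "of_nat (Suc n) * poly (szego_rev p (Suc n)) z = of_real s * B + of_real p * A"
    using poly_szego_Suc[of n p z] by (simp_all add: A_def B_def s_def)
  have sp: "p < s" by (simp add: s_def)
  have "0 \<le> (s\<^sup>2 - p\<^sup>2) * ((norm A)\<^sup>2 - (norm B)\<^sup>2)"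
    using sp assms(1) BA by (intro mult_nonneg_nonneg) (auto simp: power_mono)
  then have "(norm (of_real s * B + of_real p * A))\<^sup>2 \<le> (norm (of_real s * A + of_real p * B))\<^sup>2"
    using norm_reflected_combination[of s A p B] by linarith
  then have "norm (of_real s * B + of_real p * A) \<le> norm (of_real s * A + of_real p * B)"
    by (rule power2_le_imp_le) simp
  then have le: "real (Suc n) * norm (poly (szego_rev p (Suc n)) z)
      \<le> real (Suc n) * norm (poly (szego p (Suc n)) z)"
    unfolding rec[symmetric] norm_mult norm_of_nat .
  have "p * norm B \<le> p * norm A"
    using BA assms(1) by simp
  also have "\<dots> < s * norm A"
    using A0 sp by simp
  finally have "norm (of_real p * B) < norm (of_real s * A)"
    using assms(1) sp by (simp add: norm_mult)
  then have "of_real s * A + of_real p * B \<noteq> 0"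
    by (metis add_eq_0_iff norm_minus_cancel order_less_irrefl)
  then show ?case
    using le rec(1) by (auto simp del: szego.simps szego_rev.simps)
qed

lemma szego_norm_eq_rev:
  assumes "norm z = 1"
  shows "norm (poly (szego_rev p n) z) = norm (poly (szego p n) z)"
proof (induction n)
  case 0
  show ?case by simp
next
  case (Suc n)
  define A where "A = z * poly (szego p n) z"
  define B where "B = poly (szego_rev p n) z"
  define s where "s = real (Suc n) + p"
  have "norm B = norm A"
    using Suc assms by (simp add: A_def B_def norm_mult)
  then have "(norm (of_real s * A + of_real p * B))\<^sup>2 = (norm (of_real s * B + of_real p * A))\<^sup>2"
    using norm_reflected_combination[of s A p B] by simp
  then have "norm (of_real s * A + of_real p * B) = norm (of_real s * B + of_real p * A)"
    by (simp add: power2_eq_iff_nonneg)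
  moreover have rec: "of_nat (Suc n) * poly (szego p (Suc n)) z = of_real s * A + of_real p * B"
    "of_nat (Suc n) * poly (szego_rev p (Suc n)) z = of_real s * B + of_real p * A"
    using poly_szego_Suc[of n p z] by (simp_all add: A_def B_def s_def)
  ultimately have "norm (of_nat (Suc n) * poly (szego p (Suc n)) z)
      = norm (of_nat (Suc n) * poly (szego_rev p (Suc n)) z)"
    by metis
  then have "real (Suc n) * norm (poly (szego p (Suc n)) z)
      = real (Suc n) * norm (poly (szego_rev p (Suc n)) z)"
    unfolding norm_mult norm_of_nat .
  then show ?case
    by (simp del: szego.simps szego_rev.simps)
qed

lemma degree_szego:
  "degree (szego p n) \<le> n" "degree (szego_rev p n) \<le> n"
proof (induction n)
  case 0
  { case 1 show ?case by simp }
  { case 2 show ?case by simp }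
next
  case (Suc n)
  have *: "degree (pCons 0 (szego p n)) \<le> Suc n" "degree (szego_rev p n) \<le> Suc n"
    using Suc.IH by (auto intro: order_trans[OF degree_pCons_le])
  {
    case 1
    show ?case
      unfolding szego.simps using *
      by (intro order_trans[OF degree_smult_le] degree_add_le)
  next
    case 2
    show ?case
      unfolding szego_rev.simps using *
      by (intro order_trans[OF degree_smult_le] degree_add_le)
  }
qed

text \<open>Positive top coefficients cannot cancel in the sum \<open>para_szego\<close>; this fixes
  the degree of \<open>extremal_poly\<close>.\<close>

lemma coeff_szego_top:
  assumes "p > 0"
  shows "\<exists>u>0. coeff (szego p n) n = of_real u"
    and "\<exists>v>0. coeff (szego_rev p n) n = of_real v"
proof (induction n)
  case 0
  { case 1 show ?case by (intro exI[of _ 1]) simp }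
  { case 2 show ?case by (intro exI[of _ 1]) simp }
next
  case (Suc n)
  obtain u where u: "u > 0" "coeff (szego p n) n = of_real u"
    using Suc.IH by blast
  have v: "coeff (szego_rev p n) (Suc n) = 0"
    using degree_szego(2)[of p n] by (intro coeff_eq_0) simp
  {
    case 1
    have "0 < (real (Suc n) + p) * u / real (Suc n)"
      using u assms by (intro divide_pos_pos mult_pos_pos) auto
    then show ?case
      using u v by (intro exI[of _ "(real (Suc n) + p) * u / real (Suc n)"]) simp
  next
    case 2
    show ?case
      using u v assms by (intro exI[of _ "p * u / real (Suc n)"]) (simp add: field_simps)
  }
qed

section \<open>The equilibrium polynomial and its differential equation\<close>

text \<open>The \<open>q\<close> of the overview, a paraorthogonal polynomial: at
  \<open>z = exp (i * x)\<close> it is a constant times \<open>exp (i * n * x / 2)\<close> times the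
  Gegenbauer polynomial of degree \<open>n\<close> and parameter \<open>p\<close> at
  \<open>cos (x / 2)\<close>.\<close>

definition para_szego :: "real \<Rightarrow> nat \<Rightarrow> complex poly" where
  "para_szego p n = szego p n + szego_rev p n"

lemma para_szego_derivative:
  "z * poly (pderiv (para_szego p n)) z =
     (of_real p + of_nat n) * poly (szego p n) z - of_real p * poly (szego_rev p n) z"
proof -
  \<comment> \<open>The relations of \<open>szego_derivative\<close> yield the claim only after
    multiplication by \<open>1 - z\<close>; cancelling this factor as a polynomial covers
    \<open>z = 1\<close> too.\<close>
  define r where "r = pCons 0 (pderiv (para_szego p n)) - smult (of_real p + of_nat n) (szego p n)
      + smult (of_real p) (szego_rev p n)"
  have "poly ([:1, -1:] * r) w = 0" for w
    using szego_derivative[of w p n]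
    by (simp add: r_def para_szego_def pderiv_add) algebra
  then have "[:1, -1:] * r = 0"
    using poly_all_0_iff_0 by blast
  then have "r = 0"
    unfolding mult_eq_0_iff by simp
  then have "poly r z = 0" by simp
  then show ?thesis
    by (simp add: r_def algebra_simps)
qed

text \<open>Differentiate \<open>para_szego_derivative\<close> and eliminate the two Szego
  polynomials. At a zero of \<open>q\<close> the last term drops out and the rest is the Stieltjes
  equilibrium condition for the charge \<open>p\<close> at \<open>1\<close>.\<close>

lemma para_szego_ode:
  "z * (1 - z) * poly (pderiv (pderiv (para_szego p n))) z =
    (of_real p * (1 + z) + (of_nat n - 1) * (1 - z)) * poly (pderiv (para_szego p n)) z
      - of_nat n * of_real p * poly (para_szego p n) z"
proof -
  have "poly (pCons 0 (pderiv (para_szego p n))) w = poly (smult (of_real p + of_nat n) (szego p n)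
      - smult (of_real p) (szego_rev p n)) w" for w
    using para_szego_derivative[of w p n] by simp
  then have "pCons 0 (pderiv (para_szego p n)) = smult (of_real p + of_nat n) (szego p n)
      - smult (of_real p) (szego_rev p n)"
    by (intro poly_eq_poly_eq_iff[THEN iffD1] ext)
  then have "poly (pderiv (pCons 0 (pderiv (para_szego p n)))) z =
     poly (pderiv (smult (of_real p + of_nat n) (szego p n) - smult (of_real p) (szego_rev p n))) z"
    by simp
  then have d: "poly (pderiv (para_szego p n)) z + z * poly (pderiv (pderiv (para_szego p n))) z =
     (of_real p + of_nat n) * poly (pderiv (szego p n)) z - of_real p * poly (pderiv (szego_rev p n)) z"
    by (simp add: pderiv_pCons pderiv_diff pderiv_smult)
  have q: "poly (para_szego p n) z = poly (szego p n) z + poly (szego_rev p n) z"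
    "poly (pderiv (para_szego p n)) z = poly (pderiv (szego p n)) z + poly (pderiv (szego_rev p n)) z"
    by (simp_all add: para_szego_def pderiv_add)
  show ?thesis
    using d q para_szego_derivative[of z p n] szego_derivative(2)[of z p n] by algebra
qed

text \<open>The \<open>N\<close> of the overview.
  \<open>N / ((z - 1) q) = p / (z - 1) + q' / q\<close> has residue \<open>p\<close> at
  \<open>1\<close> and residue \<open>1\<close> at each zero of \<open>q\<close>; on a fibre of
  \<open>z B(z)\<close> these residues are proportional to \<open>1 / (1 + F)\<close> and so
  prescribe \<open>F\<close> there.\<close>

definition extremal_poly :: "real \<Rightarrow> nat \<Rightarrow> complex poly" where
  "extremal_poly p n = smult (of_real p) (para_szego p n) - [:1, -1:] * pderiv (para_szego p n)"

lemma poly_extremal_poly: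
  "poly (extremal_poly p n) z =
     of_real p * poly (para_szego p n) z - (1 - z) * poly (pderiv (para_szego p n)) z"
  "poly (pderiv (extremal_poly p n)) z =
     (of_real p + 1) * poly (pderiv (para_szego p n)) z - (1 - z) * poly (pderiv (pderiv (para_szego p n))) z"
  unfolding extremal_poly_def pderiv_diff pderiv_smult pderiv_mult
  by (simp_all add: pderiv_pCons algebra_simps)

lemma extremal_poly_degree:
  assumes "p > 0"
  shows "degree (extremal_poly p n) = n" "extremal_poly p n \<noteq> 0"
proof -
  obtain u v where uv: "u > 0" "coeff (szego p n) n = of_real u" "v > 0"
      "coeff (szego_rev p n) n = of_real v"
    using coeff_szego_top[OF assms] by blast
  have dq: "degree (para_szego p n) \<le> n"
    unfolding para_szego_def using degree_szego by (intro degree_add_le)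
  have cq: "coeff (para_szego p n) (Suc n) = 0"
    using dq by (intro coeff_eq_0) simp
  have "coeff (extremal_poly p n) n = (of_real p + of_nat n) * coeff (para_szego p n) n"
    using cq by (cases n) (simp_all add: extremal_poly_def coeff_pderiv algebra_simps)
  also have "\<dots> = of_real ((p + real n) * (u + v))"
    using uv by (simp add: para_szego_def)
  also have "\<dots> \<noteq> 0"
    using uv assms by (simp only: of_real_eq_0_iff) (simp add: add_pos_nonneg)
  finally have c: "coeff (extremal_poly p n) n \<noteq> 0" .
  have "degree ([:1, -1:] * pderiv (para_szego p n)) \<le> n"
  proof (cases "n = 0")
    case True
    then have "degree (para_szego p n) = 0" using dq by simp
    then have "pderiv (para_szego p n) = 0" by (simp add: pderiv_eq_0_iff)
    then show ?thesis by simp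
  next
    case False
    then show ?thesis
      using dq by (intro order_trans[OF degree_mult_le]) (simp add: degree_pderiv)
  qed
  then have "degree (extremal_poly p n) \<le> n"
    unfolding extremal_poly_def using dq by (intro degree_diff_le order_trans[OF degree_smult_le])
  with c show "degree (extremal_poly p n) = n"
    by (simp add: le_antisym le_degree)
  show "extremal_poly p n \<noteq> 0"
    using c by auto
qed

text \<open>A root with \<open>norm z \<ge> 1\<close> satisfies \<open>(s z - t) U = - p V\<close>
  where \<open>s = t + p\<close>. Then \<open>norm V \<le> norm U\<close> gives
  \<open>norm (s z - t) \<le> p\<close>, whereas
  \<open>norm (s z - t) \<ge> s * norm z - t \<ge> p\<close> with equality only at
  \<open>z = 1\<close>. There \<open>U = V\<close> and \<open>N\<close> takes the nonzero value
  \<open>2 p U\<close>.\<close>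

lemma extremal_poly_roots:
  assumes "p > 0" "poly (extremal_poly p n) z = 0"
  shows "norm z < 1"
proof (rule ccontr)
  assume "\<not> norm z < 1"
  then have z1: "norm z \<ge> 1" by simp
  define U where "U = poly (szego p n) z"
  define V where "V = poly (szego_rev p n) z"
  define s where "s = 2 * p + real n"
  define t where "t = p + real n"
  have U0: "norm U > 0" and VU: "norm V \<le> norm U"
    using szego_dominates_rev[OF assms(1) z1, of n] by (auto simp: U_def V_def)
  have q: "poly (para_szego p n) z = U + V"
    by (simp add: para_szego_def U_def V_def)
  have qd: "z * poly (pderiv (para_szego p n)) z = (of_real p + of_nat n) * U - of_real p * V"
    using para_szego_derivative[of z p n] by (simp add: U_def V_def)
  have st: "of_real s = 2 * of_real p + (of_nat n :: complex)"
      "of_real t = of_real p + (of_nat n :: complex)"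
    by (simp_all add: s_def t_def)
  have "(of_real s * z - of_real t) * U = - (of_real p * V)"
    using assms(2) q qd unfolding poly_extremal_poly st by algebra
  then have "norm (of_real s * z - of_real t) * norm U = p * norm V"
    using assms(1) by (metis abs_of_pos norm_minus_cancel norm_mult norm_of_real)
  also have "\<dots> \<le> p * norm U"
    using VU assms(1) by simp
  finally have "norm (of_real s * z - of_real t) \<le> p"
    using U0 by simp
  then have "(norm (of_real s * z - of_real t))\<^sup>2 \<le> p\<^sup>2"
    by (intro power_mono) auto
  \<comment> \<open>The second term measures the deviation from the positive real axis; it must
    vanish, which forces \<open>Re z = norm z\<close>.\<close>
  moreover have "(norm (of_real s * z - of_real t))\<^sup>2 = (s * norm z - t)\<^sup>2 + 2 * s * t * (norm z - Re z)"
    using cmod_power2[of z] unfolding cmod_power2[of "of_real s * z - of_real t"]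
    by (simp add: power2_eq_square algebra_simps)
  moreover have "p \<le> s * norm z - t"
  proof -
    have "s * 1 \<le> s * norm z"
      using z1 assms(1) by (intro mult_left_mono) (auto simp: s_def)
    then show ?thesis by (simp add: s_def t_def)
  qed
  then have "p\<^sup>2 \<le> (s * norm z - t)\<^sup>2"
    using assms(1) by (intro power_mono) auto
  moreover have stpos: "s > 0" "t > 0"
    using assms(1) by (simp_all add: s_def t_def add_pos_nonneg)
  moreover have "norm z - Re z \<ge> 0"
    by (simp add: complex_Re_le_cmod)
  then have "2 * s * t * (norm z - Re z) \<ge> 0"
    using stpos by (intro mult_nonneg_nonneg) auto
  ultimately have "2 * s * t * (norm z - Re z) = 0" and sq: "(s * norm z - t)\<^sup>2 = p\<^sup>2"
    by linarith+
  then have rz: "Re z = norm z"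
    using stpos by simp
  have "s * norm z - t = p"
    using sq \<open>p \<le> s * norm z - t\<close> assms(1) by (simp add: power2_eq_iff_nonneg)
  moreover have "s = t + p"
    by (simp add: s_def t_def)
  ultimately have "s * norm z = s * 1"
    by linarith
  then have "norm z = 1"
    using stpos by simp
  then have "z = 1"
    using rz cmod_power2[of z] by (simp add: complex_eq_iff)
  then have "p * (U + V) = 0"
    using assms(2) q by (simp add: poly_extremal_poly)
  moreover have "U = V"
    using szego_derivative(2)[of z p n] \<open>z = 1\<close> assms(1) by (simp add: U_def V_def)
  ultimately show False
    using U0 assms(1) by simp
qed

section \<open>From a polynomial to the Poisson sum of its zeros\<close>

lemma poly_pderiv_prod_roots:
  fixes a :: "nat \<Rightarrow> complex"
  assumes "\<forall>k<n. z \<noteq> a k"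
  shows "poly (pderiv (\<Prod>k<n. [:- a k, 1:])) z =
    poly (\<Prod>k<n. [:- a k, 1:]) z * (\<Sum>k<n. 1 / (z - a k))"
  using assms
proof (induction n)
  case 0
  show ?case by simp
next
  case (Suc n)
  then have "z - a n \<noteq> 0" by simp
  with Suc show ?case
    unfolding prod.lessThan_Suc pderiv_mult by (simp add: pderiv_pCons field_simps)
qed

text \<open>Sum \<open>(z + a) / (z - a) = 2 z / (z - a) - 1\<close> over the zeros.\<close>

lemma poisson_sum_log_derivative:
  assumes "P = smult c (\<Prod>k<n. [:- a k, 1:])" "poly P z \<noteq> 0"
  shows "poisson_sum n a z = Re (2 * z * poly (pderiv P) z / poly P z) - real n"
proof -
  have nz: "z \<noteq> a k" if "k < n" for k
    using assms that by (auto simp: poly_prod)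
  have "poly (pderiv P) z / poly P z = (\<Sum>k<n. 1 / (z - a k))"
    using assms poly_pderiv_prod_roots[of n z a] nz by (simp add: pderiv_smult)
  then have "2 * z * (poly (pderiv P) z / poly P z) = (\<Sum>k<n. 2 * z * (1 / (z - a k)))"
    by (simp only: sum_distrib_left)
  then have "2 * z * poly (pderiv P) z / poly P z = (\<Sum>k<n. 2 * z / (z - a k))"
    by simp
  also have "\<dots> = (\<Sum>k<n. (z + a k) / (z - a k) + 1)"
  proof (rule sum.cong[OF refl])
    fix k assume "k \<in> {..<n}"
    then have "z - a k \<noteq> 0" using nz by simp
    then show "2 * z / (z - a k) = (z + a k) / (z - a k) + 1"
      by (simp add: field_simps)
  qed
  finally show ?thesis
    by (simp add: poisson_sum_def sum.distrib)
qed

lemma complex_poly_roots_indexed: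
  fixes P :: "complex poly"
  assumes "P \<noteq> 0" "degree P = n"
  obtains a where "P = smult (lead_coeff P) (\<Prod>k<n. [:- a k, 1:])"
proof -
  obtain A where A: "size A = degree P" "P = smult (lead_coeff P) (\<Prod>x\<in>#A. [:- x, 1:])"
    using alg_closed_imp_factorization[OF assms(1)] by blast
  obtain xs where xs: "mset xs = A"
    using ex_mset by blast
  have "(\<Prod>x\<in>#A. [:- x, 1:]) = prod_list (map (\<lambda>x. [:- x, 1:]) xs)"
    unfolding xs[symmetric] by (simp add: prod_mset_prod_list flip: mset_map)
  also have "\<dots> = (\<Prod>k<n. [:- (xs ! k), 1:])"
    using A(1) assms(2) xs by (auto simp: prod.list_conv_set_nth atLeast0LessThan)
  finally show ?thesis
    using A(2) that[of "\<lambda>k. xs ! k"] by simp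
qed

text \<open>The number \<open>t\<close> is \<open>p (p + n) |q|^2 / |N|^2\<close>. For
  \<open>p < 1\<close> the constant \<open>n - 1 + p\<close> thus bounds \<open>F\<close> from
  below, for \<open>p > 1\<close> from above.\<close>

lemma extremal_zeros:
  assumes "p > 0"
  obtains a where "\<forall>k<n. norm (a k) < 1"
    and "poisson_sum n a 1 = real n / p"
    and "\<And>z. norm z = 1 \<Longrightarrow> \<exists>t\<ge>0. poisson_sum n a z = real n - 1 + p + (1 - p) * t"
proof -
  define P where "P = extremal_poly p n"
  obtain a where a: "P = smult (lead_coeff P) (\<Prod>k<n. [:- a k, 1:])"
    using complex_poly_roots_indexed extremal_poly_degree[OF assms] unfolding P_def by metis
  have roots: "norm (a k) < 1" if "k < n" for k
  proof -
    have "poly P (a k) = 0"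
      using that by (subst a) (auto simp: poly_prod)
    then show ?thesis
      using extremal_poly_roots[OF assms] by (simp add: P_def)
  qed
  have nz: "poly P z \<noteq> 0" if "norm z = 1" for z
    using extremal_poly_roots[OF assms, of n z] that by (auto simp: P_def)
  define q where "q = poly (para_szego p n)"
  define q' where "q' = poly (pderiv (para_szego p n))"
  have P: "poly P z = of_real p * q z - (1 - z) * q' z" for z
    by (simp add: P_def q_def q'_def poly_extremal_poly)
  \<comment> \<open>The differential equation removes \<open>q''\<close>; splitting off a multiple
    of \<open>N\<close> leaves a remainder with the factor \<open>1 - p\<close>.\<close>
  have key: "2 * z * poly (pderiv P) z =
      (2 * of_nat n - 1 + of_real p) * poly P z + (1 - of_real p) * (of_real p * q z + (1 + z) * q' z)" for z
    using para_szego_ode[of z p n]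
    unfolding P unfolding P_def poly_extremal_poly q_def[symmetric] q'_def[symmetric]
    by algebra
  have F: "poisson_sum n a z = real n - 1 + p +
      (1 - p) * Re ((of_real p * q z + (1 + z) * q' z) / poly P z)" if "norm z = 1" for z
  proof -
    have "2 * z * poly (pderiv P) z / poly P z = of_real (2 * real n - 1 + p)
       + of_real (1 - p) * ((of_real p * q z + (1 + z) * q' z) / poly P z)"
      unfolding key using nz[OF that] by (simp add: field_simps)
    moreover have "Re (of_real x + of_real y * w) = x + y * Re w" for x y w
      by simp
    ultimately have "Re (2 * z * poly (pderiv P) z / poly P z) = 2 * real n - 1 + p
       + (1 - p) * Re ((of_real p * q z + (1 + z) * q' z) / poly P z)"
      by (simp only:)
    then show ?thesis
      unfolding poisson_sum_log_derivative[OF a nz[OF that]] by linarith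
  qed
  show ?thesis
  proof
    show "\<forall>k<n. norm (a k) < 1" using roots by blast
    \<comment> \<open>At \<open>z = 1\<close> the second-order term of the differential equation
      vanishes, which gives the ratio of \<open>q'\<close> to \<open>q\<close>.\<close>
    have "of_real p * (2 * q' 1) = of_real p * (of_nat n * q 1)"
      using para_szego_ode[of 1 p n] by (simp add: q_def q'_def)
    then have "2 * q' 1 = of_nat n * q 1"
      using assms by simp
    moreover have "q 1 \<noteq> 0"
      using nz[of 1] P[of 1] by auto
    ultimately have "(of_real p * q 1 + (1 + 1) * q' 1) / poly P 1 = of_real ((p + real n) / p)"
      unfolding P using assms by (simp add: field_simps)
    then have "Re ((of_real p * q 1 + (1 + 1) * q' 1) / poly P 1) = (p + real n) / p"
      by simp
    then have "poisson_sum n a 1 = real n - 1 + p + (1 - p) * ((p + real n) / p)"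
      using F[OF norm_one] by (simp only:)
    then show "poisson_sum n a 1 = real n / p"
      using assms by (simp add: field_simps)
    fix z :: complex assume z: "norm z = 1"
    have zz: "(Re z)\<^sup>2 + (Im z)\<^sup>2 = 1"
      using z cmod_power2[of z] by simp
    define U where "U = poly (szego p n) z"
    define V where "V = poly (szego_rev p n) z"
    have UV: "(Re U)\<^sup>2 + (Im U)\<^sup>2 = (Re V)\<^sup>2 + (Im V)\<^sup>2"
      using szego_norm_eq_rev[OF z, of p n] by (simp add: U_def V_def flip: cmod_power2)
    have qz: "q z = U + V" and qd: "z * q' z = (of_real p + of_nat n) * U - of_real p * V"
      using para_szego_derivative[of z p n] by (simp_all add: q_def q'_def para_szego_def U_def V_def)
    \<comment> \<open>This is \<open>Re (z q' / q) = n / 2\<close> multiplied by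
      \<open>|q|^2\<close>, so that zeros of \<open>q\<close> on the circle are included; the
      remainder vanishes by \<open>|U| = |V|\<close>.\<close>
    have "Re (z * q' z * cnj (q z)) = real n / 2 * (norm (q z))\<^sup>2
        + (p + real n / 2) * (((Re U)\<^sup>2 + (Im U)\<^sup>2) - ((Re V)\<^sup>2 + (Im V)\<^sup>2))"
      unfolding qz qd cmod_power2 by (simp add: power2_eq_square field_simps)
    then have re1: "Re (z * q' z * cnj (q z)) = real n / 2 * (norm (q z))\<^sup>2"
      using UV by simp
    have re2: "Re ((of_real p * q z + (1 + z) * q' z) * cnj (of_real p * q z - (1 - z) * q' z))
       = p\<^sup>2 * (norm (q z))\<^sup>2 + 2 * p * Re (z * q' z * cnj (q z))
         - (1 - ((Re z)\<^sup>2 + (Im z)\<^sup>2)) * (norm (q' z))\<^sup>2"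
      unfolding cmod_power2 by (simp add: power2_eq_square algebra_simps)
    have "Re ((of_real p * q z + (1 + z) * q' z) * cnj (poly P z)) = p * (p + real n) * (norm (q z))\<^sup>2"
      unfolding P re2 re1 zz by (simp add: power2_eq_square algebra_simps)
    then have "Re ((of_real p * q z + (1 + z) * q' z) / poly P z) \<ge> 0"
      using assms by (subst complex_div_cnj) (simp add: Re_divide_of_real flip: of_real_power)
    then show "\<exists>t\<ge>0. poisson_sum n a z = real n - 1 + p + (1 - p) * t"
      using F[OF z] by blast
  qed
qed

section \<open>Extrema on the circle and dilation of the zeros\<close>

definition circle_max :: "nat \<Rightarrow> (nat \<Rightarrow> complex) \<Rightarrow> real" where
  "circle_max n a = (SUP z\<in>sphere 0 1. poisson_sum n a z)"

definition circle_min :: "nat \<Rightarrow> (nat \<Rightarrow> complex) \<Rightarrow> real" where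
  "circle_min n a = (INF z\<in>sphere 0 1. poisson_sum n a z)"

lemma maxderiv_blaschke:
  assumes "norm alpha = 1" "\<forall>k<n. norm (a k) < 1"
  shows "maxderiv (blaschke alpha a n) = circle_max n a"
  unfolding maxderiv_def circle_max_def
  using norm_deriv_blaschke[OF assms] by (intro SUP_cong) auto

lemma minderiv_blaschke:
  assumes "norm alpha = 1" "\<forall>k<n. norm (a k) < 1"
  shows "minderiv (blaschke alpha a n) = circle_min n a"
  unfolding minderiv_def circle_min_def
  using norm_deriv_blaschke[OF assms] by (intro INF_cong) auto

section \<open>Continuous dependence of the extrema on the zeros\<close>

lemma continuous_on_poisson_sum:
  assumes "\<forall>k<n. norm (a k) < 1"
  shows "continuous_on (sphere 0 1) (\<lambda>z. poisson_sum n a z)"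
  unfolding poisson_sum_def
  using assms by (intro continuous_intros) auto

lemma circle_max_attained:
  assumes "\<forall>k<n. norm (a k) < 1"
  obtains z where "norm z = 1" "poisson_sum n a z = circle_max n a"
    "\<And>w. norm w = 1 \<Longrightarrow> poisson_sum n a w \<le> circle_max n a"
proof -
  obtain z where z: "z \<in> sphere 0 1" "\<forall>w\<in>sphere 0 1. poisson_sum n a w \<le> poisson_sum n a z"
    using continuous_attains_sup[OF compact_sphere _ continuous_on_poisson_sum[OF assms]] by auto
  then have "circle_max n a = poisson_sum n a z"
    unfolding circle_max_def by (intro cSup_eq_maximum) auto
  with z show ?thesis
    by (intro that[of z]) auto
qed

lemma circle_min_attained:
  assumes "\<forall>k<n. norm (a k) < 1"
  obtains z where "norm z = 1" "poisson_sum n a z = circle_min n a"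
    "\<And>w. norm w = 1 \<Longrightarrow> circle_min n a \<le> poisson_sum n a w"
proof -
  obtain z where z: "z \<in> sphere 0 1" "\<forall>w\<in>sphere 0 1. poisson_sum n a z \<le> poisson_sum n a w"
    using continuous_attains_inf[OF compact_sphere _ continuous_on_poisson_sum[OF assms]] by auto
  then have "circle_min n a = poisson_sum n a z"
    unfolding circle_min_def by (intro cInf_eq_minimum) auto
  with z show ?thesis
    by (intro that[of z]) auto
qed

text \<open>Two kernels differ by the real part of \<open>2 z (a - b) / ((z - a) (z - b))\<close>,
  and both denominators have modulus at least \<open>1 - r\<close>. The bound is uniform in
  \<open>z\<close>, hence passes to the extrema.\<close>

lemma poisson_sum_lipschitz:
  assumes "r < 1" "\<forall>k<n. norm (a k) \<le> r" "\<forall>k<n. norm (b k) \<le> r" "norm z = 1"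
  shows "\<bar>poisson_sum n a z - poisson_sum n b z\<bar> \<le> (\<Sum>k<n. 2 / (1 - r)\<^sup>2 * norm (a k - b k))"
proof -
  have "\<bar>Re ((z + a k) / (z - a k)) - Re ((z + b k) / (z - b k))\<bar> \<le> 2 / (1 - r)\<^sup>2 * norm (a k - b k)"
    if "k < n" for k
  proof -
    have a: "1 - r \<le> norm (z - a k)" and b: "1 - r \<le> norm (z - b k)"
      using assms that norm_triangle_ineq2[of z "a k"] norm_triangle_ineq2[of z "b k"] by force+
    then have "z - a k \<noteq> 0" "z - b k \<noteq> 0"
      using assms(1) by auto
    then have "(z + a k) / (z - a k) - (z + b k) / (z - b k)
        = 2 * z * (a k - b k) / ((z - a k) * (z - b k))"
      by (simp add: field_simps)
    then have "norm ((z + a k) / (z - a k) - (z + b k) / (z - b k))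
        = 2 * norm (a k - b k) / (norm (z - a k) * norm (z - b k))"
      using assms(4) by (simp add: norm_mult norm_divide)
    also have "\<dots> \<le> 2 * norm (a k - b k) / ((1 - r) * (1 - r))"
      using a b assms(1) by (intro divide_left_mono mult_mono mult_pos_pos) auto
    finally have "norm ((z + a k) / (z - a k) - (z + b k) / (z - b k))
        \<le> 2 / (1 - r)\<^sup>2 * norm (a k - b k)"
      by (simp add: power2_eq_square)
    then show ?thesis
      using abs_Re_le_cmod[of "(z + a k) / (z - a k) - (z + b k) / (z - b k)"]
      by simp
  qed
  then have "(\<Sum>k<n. \<bar>Re ((z + a k) / (z - a k)) - Re ((z + b k) / (z - b k))\<bar>)
      \<le> (\<Sum>k<n. 2 / (1 - r)\<^sup>2 * norm (a k - b k))"
    by (intro sum_mono) auto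
  then show ?thesis
    unfolding poisson_sum_def sum_subtractf[symmetric] by (rule order_trans[OF sum_abs])
qed

lemma circle_extrema_lipschitz:
  assumes "r < 1" "\<forall>k<n. norm (a k) \<le> r" "\<forall>k<n. norm (b k) \<le> r"
  shows "\<bar>circle_max n a - circle_max n b\<bar> \<le> (\<Sum>k<n. 2 / (1 - r)\<^sup>2 * norm (a k - b k))"
    and "\<bar>circle_min n a - circle_min n b\<bar> \<le> (\<Sum>k<n. 2 / (1 - r)\<^sup>2 * norm (a k - b k))"
proof -
  have a: "\<forall>k<n. norm (a k) < 1" and b: "\<forall>k<n. norm (b k) < 1"
    using assms by force+
  note lip = poisson_sum_lipschitz[OF assms]
  obtain z where z: "norm z = 1" "poisson_sum n a z = circle_max n a"
    "\<And>w. norm w = 1 \<Longrightarrow> poisson_sum n a w \<le> circle_max n a"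
    using circle_max_attained[OF a] by blast
  obtain z' where z': "norm z' = 1" "poisson_sum n b z' = circle_max n b"
    "\<And>w. norm w = 1 \<Longrightarrow> poisson_sum n b w \<le> circle_max n b"
    using circle_max_attained[OF b] by blast
  show "\<bar>circle_max n a - circle_max n b\<bar> \<le> (\<Sum>k<n. 2 / (1 - r)\<^sup>2 * norm (a k - b k))"
    using lip[OF z(1)] lip[OF z'(1)] z z' z(3)[OF z'(1)] z'(3)[OF z(1)] by linarith
  obtain y where y: "norm y = 1" "poisson_sum n a y = circle_min n a"
    "\<And>w. norm w = 1 \<Longrightarrow> circle_min n a \<le> poisson_sum n a w"
    using circle_min_attained[OF a] by blast
  obtain y' where y': "norm y' = 1" "poisson_sum n b y' = circle_min n b"
    "\<And>w. norm w = 1 \<Longrightarrow> circle_min n b \<le> poisson_sum n b w"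
    using circle_min_attained[OF b] by blast
  show "\<bar>circle_min n a - circle_min n b\<bar> \<le> (\<Sum>k<n. 2 / (1 - r)\<^sup>2 * norm (a k - b k))"
    using lip[OF y(1)] lip[OF y'(1)] y y' y(3)[OF y'(1)] y'(3)[OF y(1)] by linarith
qed

text \<open>The common radius \<open>r < 1\<close> gives a single Lipschitz constant. The parameter
  space is general because \<open>level_set_path\<close> uses a rectangle for the maximum and an
  interval for the minimum.\<close>

lemma continuous_on_circle_extrema:
  fixes a :: "'a::topological_space \<Rightarrow> nat \<Rightarrow> complex"
  assumes "r < 1" "\<And>x k. x \<in> X \<Longrightarrow> k < n \<Longrightarrow> norm (a x k) \<le> r"
    and cont: "\<And>k. k < n \<Longrightarrow> continuous_on X (\<lambda>x. a x k)"
  shows "continuous_on X (\<lambda>x. circle_max n (a x))"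
    and "continuous_on X (\<lambda>x. circle_min n (a x))"
proof -
  have lim: "((\<lambda>x. \<Sum>k<n. 2 / (1 - r)\<^sup>2 * norm (a x k - a x0 k)) \<longlongrightarrow> 0) (at x0 within X)"
    if "x0 \<in> X" for x0
  proof -
    have "((\<lambda>x. \<Sum>k<n. 2 / (1 - r)\<^sup>2 * norm (a x k - a x0 k))
        \<longlongrightarrow> (\<Sum>k<n. 2 / (1 - r)\<^sup>2 * norm (a x0 k - a x0 k))) (at x0 within X)"
      using cont that by (intro tendsto_intros) (auto simp: continuous_on_def)
    then show ?thesis by simp
  qed
  have ev: "\<forall>\<^sub>F x in at x0 within X. x \<in> X" for x0
    by (simp add: eventually_at_filter)
  show "continuous_on X (\<lambda>x. circle_max n (a x))"
    unfolding continuous_on_def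
  proof
    fix x0 assume x0: "x0 \<in> X"
    have "norm (circle_max n (a x) - circle_max n (a x0))
        \<le> (\<Sum>k<n. 2 / (1 - r)\<^sup>2 * norm (a x k - a x0 k))" if "x \<in> X" for x
      unfolding real_norm_def using assms(2) x0 that
      by (intro circle_extrema_lipschitz(1)[OF assms(1)]) blast+
    then have "\<forall>\<^sub>F x in at x0 within X. norm (circle_max n (a x) - circle_max n (a x0))
        \<le> (\<Sum>k<n. 2 / (1 - r)\<^sup>2 * norm (a x k - a x0 k))"
      by (rule eventually_mono[OF ev])
    then show "((\<lambda>x. circle_max n (a x)) \<longlongrightarrow> circle_max n (a x0)) (at x0 within X)"
      using lim[OF x0] by (rule LIM_zero_cancel[OF Lim_null_comparison])
  qed
  show "continuous_on X (\<lambda>x. circle_min n (a x))"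
    unfolding continuous_on_def
  proof
    fix x0 assume x0: "x0 \<in> X"
    have "norm (circle_min n (a x) - circle_min n (a x0))
        \<le> (\<Sum>k<n. 2 / (1 - r)\<^sup>2 * norm (a x k - a x0 k))" if "x \<in> X" for x
      unfolding real_norm_def using assms(2) x0 that
      by (intro circle_extrema_lipschitz(2)[OF assms(1)]) blast+
    then have "\<forall>\<^sub>F x in at x0 within X. norm (circle_min n (a x) - circle_min n (a x0))
        \<le> (\<Sum>k<n. 2 / (1 - r)\<^sup>2 * norm (a x k - a x0 k))"
      by (rule eventually_mono[OF ev])
    then show "((\<lambda>x. circle_min n (a x)) \<longlongrightarrow> circle_min n (a x0)) (at x0 within X)"
      using lim[OF x0] by (rule LIM_zero_cancel[OF Lim_null_comparison])
  qed
qed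

section \<open>Dilation of the zeros and the maximum principle\<close>

text \<open>The real part is the harmonic extension of \<open>F\<close>, with variable
  \<open>w = cnj z\<close> so that the zeros enter without conjugation. Scaling all zeros by
  \<open>t\<close> becomes scaling \<open>w\<close> by \<open>t\<close>.\<close>

definition herglotz :: "nat \<Rightarrow> (nat \<Rightarrow> complex) \<Rightarrow> complex \<Rightarrow> complex" where
  "herglotz n a w = (\<Sum>k<n. (1 + a k * w) / (1 - a k * w))"

lemma Re_herglotz:
  assumes "norm z = 1"
  shows "Re (herglotz n a (of_real t * cnj z)) = poisson_sum n (\<lambda>k. of_real t * a k) z"
proof -
  have zz: "z * cnj z = 1" and z0: "z \<noteq> 0"
    using assms by (auto simp: complex_norm_square[symmetric])
  have "(1 + a k * (of_real t * cnj z)) / (1 - a k * (of_real t * cnj z))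
     = (z + of_real t * a k) / (z - of_real t * a k)" for k
  proof -
    have "(1 + a k * (of_real t * cnj z)) / (1 - a k * (of_real t * cnj z)) =
      (z * (1 + a k * (of_real t * cnj z))) / (z * (1 - a k * (of_real t * cnj z)))"
      using z0 by simp
    also have "z * (1 + a k * (of_real t * cnj z)) = z + of_real t * a k"
      using zz by algebra
    also have "z * (1 - a k * (of_real t * cnj z)) = z - of_real t * a k"
      using zz by algebra
    finally show ?thesis .
  qed
  then show ?thesis
    by (simp add: herglotz_def poisson_sum_def)
qed

lemma Re_herglotz_sphere:
  assumes "norm w = 1"
  shows "Re (herglotz n a w) = poisson_sum n a (cnj w)"
  using Re_herglotz[of "cnj w" n a 1] assms by simp

lemma herglotz_denominator:
  fixes a w :: complex
  assumes "norm a < 1" "norm w \<le> 1"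
  shows "1 - a * w \<noteq> 0"
proof
  assume "1 - a * w = 0"
  then have "a * w = 1" by simp
  then have "norm a * norm w = 1"
    by (metis norm_mult norm_one)
  moreover have "norm a * norm w \<le> norm a * 1"
    using assms(2) by (intro mult_left_mono) auto
  ultimately show False using assms(1) by simp
qed

lemma holomorphic_herglotz:
  assumes "\<forall>k<n. norm (a k) < 1"
  shows "herglotz n a holomorphic_on ball 0 1" "continuous_on (cball 0 1) (herglotz n a)"
proof -
  show "herglotz n a holomorphic_on ball 0 1"
    unfolding herglotz_def[abs_def]
    using assms herglotz_denominator by (intro holomorphic_intros) force
  show "continuous_on (cball 0 1) (herglotz n a)"
    unfolding herglotz_def[abs_def]
    using assms herglotz_denominator by (intro continuous_intros) force
qed

lemma herglotz_le_circle_max: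
  assumes "\<forall>k<n. norm (a k) < 1" "norm w \<le> 1"
  shows "Re (herglotz n a w) \<le> circle_max n a"
proof (rule maximum_real_frontier[of "herglotz n a" "cball 0 1"])
  fix z :: complex assume "z \<in> frontier (cball 0 1)"
  then have "norm z = 1" by simp
  then show "Re (herglotz n a z) \<le> circle_max n a"
    unfolding Re_herglotz_sphere[OF \<open>norm z = 1\<close>] using circle_max_attained[OF assms(1)]
    by (metis complex_mod_cnj)
qed (use assms holomorphic_herglotz[OF assms(1)] in auto)

lemma circle_min_le_herglotz:
  assumes "\<forall>k<n. norm (a k) < 1" "norm w \<le> 1"
  shows "circle_min n a \<le> Re (herglotz n a w)"
proof -
  have "Re (- herglotz n a w) \<le> - circle_min n a"
  proof (rule maximum_real_frontier[of "\<lambda>w. - herglotz n a w" "cball 0 1"])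
    fix z :: complex assume "z \<in> frontier (cball 0 1)"
    then have "norm z = 1" by simp
    then have "circle_min n a \<le> Re (herglotz n a z)"
      unfolding Re_herglotz_sphere[OF \<open>norm z = 1\<close>] using circle_min_attained[OF assms(1)]
      by (metis complex_mod_cnj)
    then show "Re (- herglotz n a z) \<le> - circle_min n a" by simp
  qed (use assms holomorphic_herglotz[OF assms(1)] in
      \<open>auto intro!: holomorphic_intros continuous_intros\<close>)
  then show ?thesis by simp
qed

text \<open>Equality at an interior point would make \<open>exp (herglotz n a)\<close> constant by
  the maximum modulus principle; since \<open>herglotz n a 0 = n\<close>, the maximum would be
  \<open>n\<close>.\<close>

lemma herglotz_less_circle_max:
  assumes "\<forall>k<n. norm (a k) < 1" "norm w < 1" "real n < circle_max n a"
  shows "Re (herglotz n a w) < circle_max n a"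
proof (rule ccontr)
  assume "\<not> Re (herglotz n a w) < circle_max n a"
  then have eq: "Re (herglotz n a w) = circle_max n a"
    using herglotz_le_circle_max[OF assms(1), of w] assms(2) by simp
  have "(\<lambda>z. exp (herglotz n a z)) constant_on ball 0 1"
  proof (rule maximum_modulus_principle[of _ _ "ball 0 1" w])
    show "(\<lambda>z. exp (herglotz n a z)) holomorphic_on ball 0 1"
      using holomorphic_herglotz(1)[OF assms(1)] by (intro holomorphic_intros)
    fix z :: complex assume "z \<in> ball 0 1"
    then show "norm (exp (herglotz n a z)) \<le> norm (exp (herglotz n a w))"
      using herglotz_le_circle_max[OF assms(1), of z] eq by simp
  qed (use assms(2) in auto)
  then have "exp (herglotz n a w) = exp (herglotz n a 0)"
    using assms(2) unfolding constant_on_def by (metis centre_in_ball mem_ball_0 zero_less_one)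
  then have "norm (exp (herglotz n a w)) = norm (exp (herglotz n a 0))"
    by simp
  then have "Re (herglotz n a w) = Re (herglotz n a 0)"
    by simp
  then show False
    using eq assms(3) by (simp add: herglotz_def)
qed

text \<open>Shrinking the zeros by \<open>u\<close> evaluates the same harmonic function on a circle
  of radius \<open>u\<close>, where it lies between its boundary extrema;
  \<open>herglotz_less_circle_max\<close> gives strictness.\<close>

lemma circle_max_scale_mono:
  assumes "0 \<le> s" "s \<le> t" "\<forall>k<n. norm (of_real t * a k) < 1"
  shows "circle_max n (\<lambda>k. of_real s * a k) \<le> circle_max n (\<lambda>k. of_real t * a k)"
    and "circle_min n (\<lambda>k. of_real t * a k) \<le> circle_min n (\<lambda>k. of_real s * a k)"
    and "s < t \<Longrightarrow> real n < circle_max n (\<lambda>k. of_real s * a k) \<Longrightarrow>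
      circle_max n (\<lambda>k. of_real s * a k) < circle_max n (\<lambda>k. of_real t * a k)"
proof -
  define b where "b = (\<lambda>k. of_real t * a k)"
  \<comment> \<open>If \<open>t = 0\<close> then also \<open>s = 0\<close>, and the default value
    \<open>u = 0\<close> of the quotient is right.\<close>
  define u where "u = s / t"
  have b: "\<forall>k<n. norm (b k) < 1" using assms(3) by (simp add: b_def)
  have u: "0 \<le> u" "u \<le> 1" using assms(1,2) by (auto simp: u_def divide_le_eq_1)
  have sb: "(\<lambda>k. of_real s * a k) = (\<lambda>k. of_real u * b k)"
    using assms(1,2) by (auto simp: b_def u_def)
  have nu: "norm (of_real u * cnj z) \<le> 1" if "norm z = 1" for z
    using u that by (simp add: norm_mult)
  have ub: "\<forall>k<n. norm (of_real u * b k) < 1"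
  proof (intro allI impI)
    fix k assume "k < n"
    have "norm (of_real u * b k) \<le> 1 * norm (b k)"
      unfolding norm_mult using u by (intro mult_right_mono) auto
    then show "norm (of_real u * b k) < 1" using b \<open>k < n\<close> by force
  qed
  obtain z where z: "norm z = 1" "poisson_sum n (\<lambda>k. of_real u * b k) z = circle_max n (\<lambda>k. of_real u * b k)"
    using circle_max_attained[OF ub] by blast
  obtain y where y: "norm y = 1" "poisson_sum n (\<lambda>k. of_real u * b k) y = circle_min n (\<lambda>k. of_real u * b k)"
    using circle_min_attained[OF ub] by blast
  have le: "circle_max n (\<lambda>k. of_real u * b k) \<le> circle_max n b"
    using herglotz_le_circle_max[OF b nu[OF z(1)]] z Re_herglotz[OF z(1), of n b u] by simp
  then show "circle_max n (\<lambda>k. of_real s * a k) \<le> circle_max n (\<lambda>k. of_real t * a k)"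
    unfolding sb b_def[symmetric] .
  have "circle_min n b \<le> circle_min n (\<lambda>k. of_real u * b k)"
    using circle_min_le_herglotz[OF b nu[OF y(1)]] y Re_herglotz[OF y(1), of n b u] by simp
  then show "circle_min n (\<lambda>k. of_real t * a k) \<le> circle_min n (\<lambda>k. of_real s * a k)"
    unfolding sb b_def[symmetric] .
  assume "s < t" and n: "real n < circle_max n (\<lambda>k. of_real s * a k)"
  then have "u < 1" using assms(1) by (simp add: u_def divide_less_eq_1)
  then have "norm (of_real u * cnj z) < 1"
    using u z(1) by (simp add: norm_mult)
  moreover have "real n < circle_max n b"
    using n le unfolding sb by simp
  ultimately have "circle_max n (\<lambda>k. of_real u * b k) < circle_max n b"
    using herglotz_less_circle_max[OF b] z Re_herglotz[OF z(1), of n b u] by metis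
  then show "circle_max n (\<lambda>k. of_real s * a k) < circle_max n (\<lambda>k. of_real t * a k)"
    unfolding sb b_def[symmetric] .
qed

section \<open>Connecting tuples inside a level set of the maximum\<close>

text \<open>In the direction of \<open>a j\<close> its own kernel is largest and the others are
  nonnegative. So the maximum blows up as a zero approaches the circle.\<close>

lemma circle_max_ge_kernel:
  assumes "\<forall>k<n. norm (a k) < 1" "j < n"
  shows "(1 + norm (a j)) / (1 - norm (a j)) \<le> circle_max n a"
proof -
  define z where "z = (if a j = 0 then 1 else sgn (a j))"
  have z: "norm z = 1" "a j = of_real (norm (a j)) * z"
    by (simp_all add: z_def norm_sgn) (simp add: sgn_eq)
  have z0: "z \<noteq> 0" using z(1) by auto
  have "(z + a j) / (z - a j) = (z * of_real (1 + norm (a j))) / (z * of_real (1 - norm (a j)))"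
    by (subst (1 2) z(2)) (simp add: algebra_simps)
  also have "\<dots> = of_real ((1 + norm (a j)) / (1 - norm (a j)))"
    using z0 by simp
  finally have j: "Re ((z + a j) / (z - a j)) = (1 + norm (a j)) / (1 - norm (a j))"
    by simp
  have "Re ((z + a j) / (z - a j)) \<le> (\<Sum>k<n. Re ((z + a k) / (z - a k)))"
  proof (rule member_le_sum)
    fix k assume "k \<in> {..<n} - {j}"
    then show "0 \<le> Re ((z + a k) / (z - a k))"
      using assms(1) z(1) by (simp add: poisson_kernel_nonneg)
  qed (use assms(2) in auto)
  then have "(1 + norm (a j)) / (1 - norm (a j)) \<le> poisson_sum n a z"
    unfolding j poisson_sum_def .
  also have "\<dots> \<le> circle_max n a"
    using circle_max_attained[OF assms(1)] z(1) by metis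
  finally show ?thesis .
qed

lemma poisson_sum_zero: "norm z = 1 \<Longrightarrow> poisson_sum n (\<lambda>k. 0) z = real n"
  by (auto simp: poisson_sum_def)

lemma circle_extrema_zero: "circle_max n (\<lambda>k. 0) = real n" "circle_min n (\<lambda>k. 0) = real n"
  using circle_max_attained[of n "\<lambda>k. 0"] circle_min_attained[of n "\<lambda>k. 0"] poisson_sum_zero
  by (metis norm_zero zero_less_one)+

text \<open>On the ray through \<open>b s\<close> the maximum rises from \<open>n\<close> to beyond
  \<open>M\<close>, strictly once it exceeds \<open>n\<close>, so it equals \<open>M\<close> at
  exactly one radius \<open>\<rho> s\<close>.\<close>

lemma level_set_path:
  fixes b :: "real \<Rightarrow> nat \<Rightarrow> complex"
  assumes M: "real n < M"
    and cont: "\<And>k. k < n \<Longrightarrow> continuous_on {0..1} (\<lambda>s. b s k)"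
    and le1: "\<And>s k. s \<in> {0..1} \<Longrightarrow> k < n \<Longrightarrow> norm (b s k) \<le> 1"
    and eq1: "\<And>s. s \<in> {0..1} \<Longrightarrow> \<exists>k<n. norm (b s k) = 1"
  obtains \<rho> :: "real \<Rightarrow> real" where
    "\<And>s. s \<in> {0..1} \<Longrightarrow> 0 \<le> \<rho> s \<and> \<rho> s < 1 \<and> circle_max n (\<lambda>k. of_real (\<rho> s) * b s k) = M"
    "continuous_on {0..1} (\<lambda>s. circle_min n (\<lambda>k. of_real (\<rho> s) * b s k))"
proof -
  \<comment> \<open>At radius \<open>r\<close> the kernel bound is \<open>2 * M + 1 > M\<close>. The
    level \<open>M\<close> is therefore reached within radius \<open>r\<close>, and all tuples stay
    in a fixed compact part of the disc.\<close>
  define r where "r = M / (M + 1)"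
  have M0: "M > 0" using M by (meson of_nat_0_le_iff order_le_less_trans)
  then have r: "0 \<le> r" "r < 1" by (auto simp: r_def)
  have rM: "(1 + r) / (1 - r) = 2 * M + 1"
    using M0 by (simp add: r_def field_simps)
  define X where "X = {0..1::real} \<times> {0..r}"
  define h where "h = (\<lambda>x. circle_max n (\<lambda>k. of_real (snd x) * b (fst x) k))"
  have bound: "norm (of_real t * b s k) \<le> r" if "s \<in> {0..1}" "t \<in> {0..r}" "k < n" for s t k
  proof -
    have "norm (of_real t * b s k) \<le> r * 1"
      unfolding norm_mult using that le1[of s k] r by (intro mult_mono) auto
    then show ?thesis by simp
  qed
  have h: "continuous_on X h"
    unfolding h_def
  proof (rule continuous_on_circle_extrema(1)[OF r(2)])
    show "norm (of_real (snd x) * b (fst x) k) \<le> r" if "x \<in> X" "k < n" for x k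
      using that bound by (auto simp: X_def)
    show "continuous_on X (\<lambda>x. of_real (snd x) * b (fst x) k)" if "k < n" for k
      by (intro continuous_intros continuous_on_compose2[OF cont[OF that]]) (auto simp: X_def)
  qed
  have small: "\<forall>k<n. norm (of_real t * b s k) < 1" if "s \<in> {0..1}" "t \<in> {0..r}" for s t
    using bound[OF that] r(2) by force
  have "\<exists>t\<in>{0..r}. h (s, t) = M" if s: "s \<in> {0..1}" for s
  proof -
    obtain k where k: "k < n" "norm (b s k) = 1" using eq1[OF s] by blast
    have "norm (of_real r * b s k) = r" using k r by (simp add: norm_mult)
    then have "2 * M + 1 \<le> h (s, r)"
      using circle_max_ge_kernel[OF small[OF s, of r] k(1)] r rM by (simp add: h_def)
    moreover have "h (s, 0) = real n"
      by (simp add: h_def circle_extrema_zero)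
    moreover have "continuous_on {0..r} (\<lambda>t. h (s, t))"
      using s by (intro continuous_on_compose2[OF h] continuous_intros) (auto simp: X_def)
    ultimately show ?thesis
      using IVT'[of "\<lambda>t. h (s, t)" 0 M r] M M0 r by force
  qed
  then obtain \<rho> where \<rho>: "\<And>s. s \<in> {0..1} \<Longrightarrow> \<rho> s \<in> {0..r} \<and> h (s, \<rho> s) = M"
    by metis
  have unique: "t = \<rho> s" if "s \<in> {0..1}" "t \<in> {0..r}" "h (s, t) = M" for s t
  proof -
    have *: "\<not> u < v" if "u \<in> {0..r}" "v \<in> {0..r}" "h (s, u) = M" "h (s, v) = M" for u v
      using circle_max_scale_mono(3)[of u v n "b s"] small[OF \<open>s \<in> {0..1}\<close> that(2)] that M
      by (auto simp: h_def)
    show ?thesis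
      using *[of t "\<rho> s"] *[of "\<rho> s" t] \<rho>[OF that(1)] that by force
  qed
  \<comment> \<open>Uniqueness identifies the graph of \<open>\<rho>\<close> with the level set of
    \<open>h\<close>, which is closed; as the values lie in a compact interval,
    \<open>\<rho>\<close> is continuous.\<close>
  have "(\<lambda>s. (s, \<rho> s)) ` {0..1} = X \<inter> h -` {M}"
    using \<rho> unique by (fastforce simp: X_def)
  moreover have "closed (X \<inter> h -` {M})"
    by (rule continuous_closed_preimage[OF h]) (auto simp: X_def intro: closed_Times)
  ultimately have "continuous_on {0..1} \<rho>"
    using \<rho> by (intro continuous_from_closed_graph[of "{0..r}"]) auto
  then have "continuous_on {0..1} (\<lambda>s. circle_min n (\<lambda>k. of_real (\<rho> s) * b s k))"
    using \<rho> bound cont by (intro continuous_on_circle_extrema(2)[OF r(2)] continuous_intros) blast+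
  moreover have "0 \<le> \<rho> s \<and> \<rho> s < 1 \<and> circle_max n (\<lambda>k. of_real (\<rho> s) * b s k) = M"
    if "s \<in> {0..1}" for s
    using \<rho>[OF that] r by (auto simp: h_def)
  ultimately show ?thesis
    using that by blast
qed

lemma continuous_on_Max_norm:
  fixes f :: "'a::topological_space \<Rightarrow> nat \<Rightarrow> complex"
  assumes "0 < n" "\<And>k. k < n \<Longrightarrow> continuous_on X (\<lambda>x. f x k)"
  shows "continuous_on X (\<lambda>x. Max ((\<lambda>k. norm (f x k)) ` {..<n}))"
  using assms
proof (induction n)
  case (Suc n)
  show ?case
  proof (cases "n = 0")
    case True
    then show ?thesis using Suc.prems by (simp add: lessThan_Suc continuous_on_norm)
  next
    case False
    then have "Max ((\<lambda>k. norm (f x k)) ` {..<Suc n}) =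
        max (norm (f x n)) (Max ((\<lambda>k. norm (f x k)) ` {..<n}))" for x
      by (simp add: lessThan_Suc lessThan_empty_iff)
    moreover have "continuous_on X (\<lambda>x. max (norm (f x n)) (Max ((\<lambda>k. norm (f x k)) ` {..<n})))"
      using Suc False by (intro continuous_on_max continuous_on_norm) auto
    ultimately show ?thesis by simp
  qed
qed simp

text \<open>Hence a tuple and its negative have the same extrema, which leaves the sign of an
  endpoint free.\<close>

lemma poisson_sum_uminus: "poisson_sum n (\<lambda>k. - a k) z = poisson_sum n a (- z)"
proof -
  have "(z + - a k) / (z - - a k) = (- z + a k) / (- z - a k)" for k
    using minus_divide_divide[of "z - a k" "z + a k"] by simp
  then show ?thesis
    by (simp add: poisson_sum_def)
qed

text \<open>Project the segment from \<open>a\<close> to \<open>c\<close> radially onto the level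
  set. The start can only move inward, which does not lower the minimum; the end can only move
  outward, which does not raise it. So the minimum passes through \<open>m\<close>.\<close>

lemma connect_level_set:
  assumes n: "0 < n" and M: "real n < M"
    and a: "\<forall>k<n. norm (a k) < 1" "M \<le> circle_max n a" "m \<le> circle_min n a"
    and c: "\<forall>k<n. norm (c k) < 1" "circle_max n c \<le> M" "circle_min n c \<le> m"
    and nz: "\<And>s. s \<in> {0..1} \<Longrightarrow> \<exists>k<n. of_real (1 - s) * a k + of_real s * c k \<noteq> 0"
  shows "\<exists>d. (\<forall>k<n. norm (d k) < 1) \<and> circle_max n d = M \<and> circle_min n d = m"
proof -
  define f where "f = (\<lambda>s k. of_real (1 - s) * a k + of_real s * c k)"
  \<comment> \<open>The sup norm of the tuple: dividing by it puts the largest entry on the unit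
    circle, as \<open>level_set_path\<close> requires.\<close>
  define N where "N = (\<lambda>s. Max ((\<lambda>k. norm (f s k)) ` {..<n}))"
  define b where "b = (\<lambda>s k. f s k / of_real (N s))"
  have fc: "continuous_on {0..1} (\<lambda>s. f s k)" for k
    unfolding f_def by (intro continuous_intros)
  have Nc: "continuous_on {0..1} N"
    unfolding N_def using n fc by (intro continuous_on_Max_norm)
  have fN: "norm (f s k) \<le> N s" if "k < n" for s k
    unfolding N_def using that by (intro Max_ge) auto
  have Npos: "0 < N s" if s: "s \<in> {0..1}" for s
  proof -
    obtain k where "k < n" "f s k \<noteq> 0" using nz[OF s] by (auto simp: f_def)
    then show ?thesis using fN[of k s] by (meson less_le_trans zero_less_norm_iff)
  qed
  have Nattained: "\<exists>k<n. norm (f s k) = N s" for s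
  proof -
    have "N s \<in> (\<lambda>k. norm (f s k)) ` {..<n}"
      unfolding N_def using n by (intro Max_in) auto
    then show ?thesis by auto
  qed
  have fb: "f s k = of_real (N s) * b s k" if "s \<in> {0..1}" for s k
    using Npos[OF that] by (simp add: b_def)
  obtain \<rho> where \<rho>: "\<And>s. s \<in> {0..1} \<Longrightarrow>
        0 \<le> \<rho> s \<and> \<rho> s < 1 \<and> circle_max n (\<lambda>k. of_real (\<rho> s) * b s k) = M"
      and gc: "continuous_on {0..1} (\<lambda>s. circle_min n (\<lambda>k. of_real (\<rho> s) * b s k))"
  proof (rule level_set_path[OF M, of b])
    show "continuous_on {0..1} (\<lambda>s. b s k)" for k
      unfolding b_def using Npos
      by (intro continuous_intros fc Nc) (metis less_irrefl of_real_eq_0_iff)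
    show "norm (b s k) \<le> 1" if "s \<in> {0..1}" "k < n" for s k
      using fN[OF that(2), of s] Npos[OF that(1)] by (simp add: b_def norm_divide)
    show "\<exists>k<n. norm (b s k) = 1" if "s \<in> {0..1}" for s
      using Nattained[of s] Npos[OF that] by (auto simp: b_def norm_divide)
  qed blast
  have b1: "norm (b s k) \<le> 1" if "s \<in> {0..1}" "k < n" for s k
    using fN[OF that(2), of s] Npos[OF that(1)] by (simp add: b_def norm_divide)
  have \<rho>b: "\<forall>k<n. norm (of_real (\<rho> s) * b s k) < 1" if s: "s \<in> {0..1}" for s
  proof (intro allI impI)
    fix k assume "k < n"
    have "norm (of_real (\<rho> s) * b s k) \<le> \<rho> s * 1"
      unfolding norm_mult using b1[OF s \<open>k < n\<close>] \<rho>[OF s] by (intro mult_mono) auto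
    then show "norm (of_real (\<rho> s) * b s k) < 1" using \<rho>[OF s] by simp
  qed
  define g where "g = (\<lambda>s. circle_min n (\<lambda>k. of_real (\<rho> s) * b s k))"
  have i: "(0::real) \<in> {0..1}" "(1::real) \<in> {0..1}" by auto
  have ab: "a = (\<lambda>k. of_real (N 0) * b 0 k)" and cb: "c = (\<lambda>k. of_real (N 1) * b 1 k)"
    using fb[OF i(1)] fb[OF i(2)] by (auto simp: f_def fun_eq_iff)
  have "\<rho> 0 \<le> N 0"
  proof (rule ccontr)
    assume "\<not> \<rho> 0 \<le> N 0"
    then have "circle_max n a < circle_max n (\<lambda>k. of_real (\<rho> 0) * b 0 k)"
      unfolding ab using circle_max_scale_mono(3)[of "N 0" "\<rho> 0" n "b 0"] Npos[OF i(1)] \<rho>b[OF i(1)] a(2) M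
      unfolding ab[symmetric] by auto
    then show False using \<rho>[OF i(1)] a(2) by simp
  qed
  then have "m \<le> g 0"
    using circle_max_scale_mono(2)[of "\<rho> 0" "N 0" n "b 0"] \<rho>[OF i(1)] a(1,3)
    unfolding g_def ab[symmetric] by (auto simp flip: fun_cong[OF ab])
  have "N 1 \<le> \<rho> 1"
  proof (rule ccontr)
    assume "\<not> N 1 \<le> \<rho> 1"
    then have "circle_max n (\<lambda>k. of_real (\<rho> 1) * b 1 k) < circle_max n c"
      using circle_max_scale_mono(3)[of "\<rho> 1" "N 1" n "b 1"] \<rho>[OF i(2)] c(1) M
      unfolding cb[symmetric] by (auto simp flip: fun_cong[OF cb])
    then show False using \<rho>[OF i(2)] c(2) by simp
  qed
  then have "g 1 \<le> m"
    using circle_max_scale_mono(2)[of "N 1" "\<rho> 1" n "b 1"] Npos[OF i(2)] \<rho>b[OF i(2)] c(3)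
    unfolding g_def cb[symmetric] by auto
  then obtain s where "0 \<le> s" "s \<le> 1" "g s = m"
    using IVT2'[of g 1 m 0] \<open>m \<le> g 0\<close> gc unfolding g_def by auto
  then show ?thesis
    using \<rho>[of s] \<rho>b[of s] unfolding g_def by auto
qed

section \<open>Choice of the endpoints and conclusion\<close>

lemma poisson_sum_nonconst:
  assumes "poisson_sum n a 1 \<noteq> real n"
  shows "\<exists>k<n. a k \<noteq> 0"
proof (rule ccontr)
  assume "\<not> (\<exists>k<n. a k \<noteq> 0)"
  then have "poisson_sum n a 1 = poisson_sum n (\<lambda>k. 0) 1"
    unfolding poisson_sum_def by (intro sum.cong) auto
  then show False
    using assms poisson_sum_zero[of 1 n] by simp
qed

text \<open>A segment through zero between nonzero tuples makes its ends negative multiples of each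
  other; this cannot hold for both \<open>c\<close> and \<open>- c\<close>.\<close>

lemma segment_avoids_zero:
  fixes a c :: "nat \<Rightarrow> complex"
  assumes "\<exists>k<n. a k \<noteq> 0" "\<exists>k<n. c k \<noteq> 0"
  obtains e :: real where "e = 1 \<or> e = -1"
    "\<And>s. s \<in> {0..1} \<Longrightarrow> \<exists>k<n. of_real (1 - s) * a k + of_real s * (of_real e * c k) \<noteq> 0"
proof (rule ccontr)
  assume no: "\<not> thesis"
  note witness = that
  obtain j where j: "j < n" "a j \<noteq> 0" using assms(1) by blast
  obtain l where l: "l < n" "c l \<noteq> 0" using assms(2) by blast
  obtain u where u: "u \<in> {0..1}"
      and u0: "\<And>k. k < n \<Longrightarrow> of_real (1 - u) * a k + of_real u * (of_real 1 * c k) = 0"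
    using no witness[of 1] by blast
  obtain s where s: "s \<in> {0..1}"
      and s0: "\<And>k. k < n \<Longrightarrow> of_real (1 - s) * a k + of_real s * (of_real (-1) * c k) = 0"
    using no witness[of "-1"] by blast
  \<comment> \<open>Eliminating \<open>c\<close> from the two vanishing combinations leaves a sum of
    two nonnegative coefficients times \<open>a j\<close>.\<close>
  have "of_real ((1 - s) * u + (1 - u) * s) * a j = 0"
    using u0[OF j(1)] s0[OF j(1)] by simp algebra
  then have "(1 - s) * u + (1 - u) * s = 0"
    using j(2) by (metis mult_eq_0_iff of_real_eq_0_iff)
  moreover have "(1 - s) * u \<ge> 0" "(1 - u) * s \<ge> 0"
    using s u by auto
  ultimately have "(1 - s) * u = 0" "(1 - u) * s = 0"
    by linarith+
  then have "u = 0 \<or> u = 1"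
    by auto
  then show False
    using u0[OF j(1)] u0[OF l(1)] j(2) l(2) by auto
qed

theorem theorem1:
  fixes n :: nat and m M :: real
  assumes "m > 0" and "M > 0"
    and "real n / (M - real n + 1) \<le> m" and "m \<le> real n - 1 + real n / M"
    and "m \<le> real n" and "real n \<le> M"
  shows "\<exists>B. is_blaschke n B \<and> maxderiv B = M \<and> minderiv B = m"
proof -
  have n: "0 < n" using assms(1,5) by (cases n) auto
  have "\<exists>d. (\<forall>k<n. norm (d k) < 1) \<and> circle_max n d = M \<and> circle_min n d = m"
  proof (cases "M = real n")
    case True
    \<comment> \<open>Here the lower bound on \<open>m\<close> reads \<open>n \<le> m\<close>, so
      both extrema must be \<open>n\<close> and all zeros can be \<open>0\<close>.\<close>
    then have "m = real n" using assms(3,5) by simp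
    with True show ?thesis
      by (intro exI[of _ "\<lambda>k. 0"]) (simp add: circle_extrema_zero)
  next
    case False
    then have M: "real n < M" using assms(6) by simp
    \<comment> \<open>With this \<open>p\<close>, \<open>F(1) = n / p = M\<close> and
      \<open>F\<close> stays above \<open>n - 1 + n / M\<close>, hence above \<open>m\<close>: the
      start of the segment.\<close>
    define p where "p = real n / M"
    have p: "0 < p" "p < 1" using n M assms(2) by (auto simp: p_def)
    obtain a where a: "\<forall>k<n. norm (a k) < 1" "poisson_sum n a 1 = real n / p"
      "\<And>z. norm z = 1 \<Longrightarrow> \<exists>t\<ge>0. poisson_sum n a z = real n - 1 + p + (1 - p) * t"
      using extremal_zeros[OF p(1), of n] by blast
    have amax: "M \<le> circle_max n a"
      using circle_max_attained[OF a(1)] a(2) n assms(2) by (simp add: p_def) (metis norm_one)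
    obtain y where y: "norm y = 1" "poisson_sum n a y = circle_min n a"
      using circle_min_attained[OF a(1)] by blast
    obtain t where "t \<ge> 0" "poisson_sum n a y = real n - 1 + p + (1 - p) * t"
      using a(3)[OF y(1)] by blast
    then have amin: "m \<le> circle_min n a"
      using y p assms(4) by (simp add: p_def[symmetric] order_trans)
    \<comment> \<open>With this parameter \<open>F\<close> stays below
      \<open>n - 1 + p' = M\<close>, while \<open>F(1) = n / p'\<close> is at most \<open>m\<close>:
      the end of the segment.\<close>
    define p' where "p' = M - real n + 1"
    have p': "1 < p'" using M by (simp add: p'_def)
    obtain c where c: "\<forall>k<n. norm (c k) < 1" "poisson_sum n c 1 = real n / p'"
      "\<And>z. norm z = 1 \<Longrightarrow> \<exists>t\<ge>0. poisson_sum n c z = real n - 1 + p' + (1 - p') * t"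
      using extremal_zeros[of p' n] p' by auto
    have cM: "poisson_sum n c z \<le> M" if z: "norm z = 1" for z
    proof -
      obtain t where "t \<ge> 0" "poisson_sum n c z = real n - 1 + p' + (1 - p') * t"
        using c(3)[OF z] by blast
      moreover have "(1 - p') * t \<le> 0"
        using p' \<open>t \<ge> 0\<close> by (simp add: mult_nonpos_nonneg)
      ultimately show ?thesis by (simp add: p'_def)
    qed
    have sgn: "circle_max n (\<lambda>k. of_real e * c k) \<le> M \<and> circle_min n (\<lambda>k. of_real e * c k) \<le> m
       \<and> (\<forall>k<n. norm (of_real e * c k) < 1)" if "e = 1 \<or> e = -1" for e :: real
    proof -
      have P: "poisson_sum n (\<lambda>k. of_real e * c k) z = poisson_sum n c (of_real e * z)" for z
        using that poisson_sum_uminus[of n c z] by auto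
      have d: "\<forall>k<n. norm (of_real e * c k) < 1" and e: "norm (of_real e :: complex) = 1"
        using c(1) that by auto
      obtain z where z: "norm z = 1"
          "poisson_sum n (\<lambda>k. of_real e * c k) z = circle_max n (\<lambda>k. of_real e * c k)"
        using circle_max_attained[OF d] by blast
      have "circle_max n (\<lambda>k. of_real e * c k) \<le> M"
        using cM[of "of_real e * z"] z e P by (simp add: norm_mult)
      \<comment> \<open>The point \<open>e\<close> is used because \<open>e * e = 1\<close> turns it
        into the point \<open>1\<close> for the tuple \<open>c\<close>.\<close>
      moreover have "circle_min n (\<lambda>k. of_real e * c k) \<le> poisson_sum n (\<lambda>k. of_real e * c k) (of_real e)"
        using circle_min_attained[OF d] e by metis
      moreover have "of_real e * (of_real e :: complex) = 1"
        using that by auto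
      ultimately show ?thesis
        using d c(2) assms(3) P[of "of_real e"] by (simp add: p'_def)
    qed
    have "poisson_sum n a 1 \<noteq> real n" "poisson_sum n c 1 \<noteq> real n"
      using a(2) c(2) n M assms(2) p' by (auto simp: p_def field_simps)
    then have "\<exists>k<n. a k \<noteq> 0" "\<exists>k<n. c k \<noteq> 0"
      by (auto intro: poisson_sum_nonconst)
    then obtain e :: real where e: "e = 1 \<or> e = -1"
      and nz: "\<And>s. s \<in> {0..1} \<Longrightarrow> \<exists>k<n. of_real (1 - s) * a k + of_real s * (of_real e * c k) \<noteq> 0"
      using segment_avoids_zero by blast
    show ?thesis
      using sgn[OF e] nz
      by (intro connect_level_set[OF n M a(1) amax amin, of "\<lambda>k. of_real e * c k"]) auto
  qed
  then obtain d where d: "\<forall>k<n. norm (d k) < 1" "circle_max n d = M" "circle_min n d = m"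
    by blast
  then have "is_blaschke n (blaschke 1 d n)"
    unfolding is_blaschke_def by (intro exI[of _ 1] exI[of _ d]) simp
  then show ?thesis
    using d maxderiv_blaschke[of 1 n d] minderiv_blaschke[of 1 n d] by auto
qed

end
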